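(* Let $d\ge 0$, let $\mathcal{H}=(V,H)$ be a paving simplicial complex of dimension $d$, and let $m\ge 0$. Then $$H^{(m)} = P_{\le d+m+1}(V)\setminus\{X\in P_{d+m+1}(V) \mid P_{d+1}(X)\cap H=\emptyset\}.$$
   Context: A simplicial complex is a pair $(V,H)$ with $V$ finite nonempty, $H\subseteq 2^V$ containing all singletons and closed under subsets; its dimension is $\max\{|X|:X\in H\}-1$. $P_k(V)$ (resp. $P_{\le k}(V)$) denotes the set of subsets of $V$ with exactly (resp. at most) $k$ elements. A complex of dimension $d$ is paving if $P_{\le d}(V)\subseteq H$. The up operator is $H^{\mathrm{up}} = H\cup\{I\cup\{p\} : I\in H,\ p\in V\setminus I\}$, and $H^{(m)}$ denotes the result of applying the up operator $m$ times to $H$ (with $H^{(0)}=H$). *)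

theory Defs
  imports "HOL-Library.Ramsey"
begin

definition simplicial_complex :: "'a set \<Rightarrow> 'a set set \<Rightarrow> bool" where
  "simplicial_complex V H \<longleftrightarrow>
     finite V \<and> V \<noteq> {} \<and> H \<subseteq> Pow V \<and> (\<forall>v\<in>V. {v} \<in> H) \<and>
     (\<forall>X\<in>H. \<forall>Y. Y \<subseteq> X \<longrightarrow> Y \<in> H)"

text \<open>The natural-number subtraction never truncates on a simplicial complex: \<open>V\<close> is nonempty,
  so \<open>H\<close> contains a singleton.\<close>

definition complex_dim :: "'a set set \<Rightarrow> nat" where
  "complex_dim H = Max (card ` H) - 1"

text \<open>\<open>P\<^sub>k(V)\<close> is \<open>nsets V k\<close>; the following is \<open>P\<^sub>\<le>\<^sub>k(V)\<close>.\<close>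

definition nsets_le :: "'a set \<Rightarrow> nat \<Rightarrow> 'a set set" where
  "nsets_le V k = {X. X \<subseteq> V \<and> finite X \<and> card X \<le> k}"

definition paving :: "'a set \<Rightarrow> 'a set set \<Rightarrow> bool" where
  "paving V H \<longleftrightarrow> simplicial_complex V H \<and> nsets_le V (complex_dim H) \<subseteq> H"

definition up :: "'a set \<Rightarrow> 'a set set \<Rightarrow> 'a set set" where
  "up V H = H \<union> {I \<union> {p} | I p. I \<in> H \<and> p \<in> V - I}"

end

theory Submission
  imports Defs
begin

text \<open>Induction on \<open>m\<close>. If \<open>X\<close> has the new maximal size and contains a \<open>d\<close>-face \<open>F\<close>, deleting a
  point of \<open>X - F\<close> keeps \<open>F\<close> inside, so \<open>X\<close> arises by one application of the up operator. A set of
  the previously maximal size arises by deleting any of its points, whether or not it contains a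
  \<open>d\<close>-face.\<close>

text \<open>This reduces membership to cardinalities. Finiteness of \<open>V\<close> rules out
  infinite \<open>X\<close>, for which \<open>card X\<close> would be 0.\<close>

lemma nsets_le_diff_nsets_iff:
  assumes "finite V"
  shows "X \<in> nsets_le V k - {X \<in> nsets V k. nsets X n \<inter> H = {}} \<longleftrightarrow>
    X \<subseteq> V \<and> (card X < k \<or> card X = k \<and> (\<exists>F\<in>H. F \<subseteq> X \<and> card F = n))"
  using finite_subset[OF _ assms] finite_subset
  by (auto simp: nsets_le_def nsets_def)

text \<open>The induction step. \<open>H\<close> is an arbitrary family here and \<open>n\<close>
  stays fixed while \<open>k\<close> grows, so the faces sought inside \<open>X\<close> always come
  from the original complex, not from its iterates.\<close>

lemma up_nsets_le_diff_nsets: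
  fixes n k :: nat
  assumes "finite V" and "0 < k" and "n \<le> k"
  shows "up V (nsets_le V k - {X \<in> nsets V k. nsets X n \<inter> H = {}}) =
    nsets_le V (Suc k) - {X \<in> nsets V (Suc k). nsets X n \<inter> H = {}}"
    (is "up V ?A = ?B")
proof (rule set_eqI, rule iffI)
  note iff = nsets_le_diff_nsets_iff[OF \<open>finite V\<close>]
  fix X
  assume "X \<in> up V ?A"
  then consider "X \<in> ?A" | I p where "X = insert p I" "I \<in> ?A" "p \<in> V - I"
    unfolding up_def by auto
  then show "X \<in> ?B"
  proof cases
    case 1
    then show ?thesis unfolding iff by auto
  next
    case 2
    then have "finite I" using \<open>finite V\<close> finite_subset unfolding iff by metis
    then have "card X = Suc (card I)" using 2 by simp
    \<comment> \<open>If \<open>card I < k\<close>, then \<open>X\<close> stays below the new top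
      size; if \<open>card I = k\<close>, the face inside \<open>I\<close> also lies in
      \<open>X\<close>.\<close>
    then show ?thesis using 2 unfolding iff by auto
  qed
next
  note iff = nsets_le_diff_nsets_iff[OF \<open>finite V\<close>]
  fix X
  assume X: "X \<in> ?B"
  then have "X \<subseteq> V" unfolding iff by blast
  have step: "X \<in> up V ?A" if "p \<in> X" "X - {p} \<in> ?A" for p
  proof -
    have "X = (X - {p}) \<union> {p}" "p \<in> V - (X - {p})" using that \<open>X \<subseteq> V\<close> by auto
    then show ?thesis using that(2) unfolding up_def by blast
  qed
  consider "card X < k" | "card X = k" | "card X = Suc k"
    using X unfolding iff by linarith
  then show "X \<in> up V ?A"
  proof cases
    case 1
    then have "X \<in> ?A" using \<open>X \<subseteq> V\<close> unfolding iff by blast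
    then show ?thesis unfolding up_def by blast
  next
    case 2
    then obtain p where p: "p \<in> X" using \<open>0 < k\<close> by fastforce
    then have "card (X - {p}) < k" using 2 \<open>0 < k\<close> by simp
    then have "X - {p} \<in> ?A" using \<open>X \<subseteq> V\<close> unfolding iff by blast
    with p show ?thesis by (rule step)
  next
    case 3
    then obtain F where F: "F \<in> H" "F \<subseteq> X" "card F = n"
      using X unfolding iff by auto
    \<comment> \<open>\<open>F\<close> has \<open>n \<le> k\<close> points and \<open>X\<close> has
      \<open>k + 1\<close>, so some point of \<open>X\<close> lies outside \<open>F\<close>.\<close>
    then have "F \<noteq> X" using 3 \<open>n \<le> k\<close> by auto
    then obtain p where p: "p \<in> X" "p \<notin> F" using F by blast
    have "card (X - {p}) = k" using 3 p by simp
    then have "X - {p} \<in> ?A" using \<open>X \<subseteq> V\<close> F p unfolding iff by blast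
    with p(1) show ?thesis by (rule step)
  qed
qed

text \<open>The base case. The dimension excludes larger sets, paving supplies the smaller ones, and
  a set of size \<open>d + 1\<close> has only itself as a subset of that size.\<close>

lemma paving_eq_nsets_le_diff_nsets:
  assumes "paving V H" and "complex_dim H = d"
  shows "H = nsets_le V (d + 1) - {X \<in> nsets V (d + 1). nsets X (d + 1) \<inter> H = {}}"
proof -
  have "finite V" and sub: "H \<subseteq> Pow V" and low: "nsets_le V d \<subseteq> H"
    using assms unfolding paving_def simplicial_complex_def by auto
  have fin: "finite X" if "X \<subseteq> V" for X using that \<open>finite V\<close> finite_subset by blast
  have "finite H" using sub \<open>finite V\<close> finite_subset by blast
  then have "card X \<le> Max (card ` H)" if "X \<in> H" for X using that by simp
  \<comment> \<open>The upper bound follows from the value \<open>d\<close> of the subtraction even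
    if it were truncated.\<close>
  then have card_le: "card X \<le> d + 1" if "X \<in> H" for X
    using that assms(2) unfolding complex_dim_def by fastforce
  show ?thesis
  proof (rule set_eqI)
    fix X
    have "X \<in> H \<longleftrightarrow> X \<subseteq> V \<and>
        (card X < d + 1 \<or> card X = d + 1 \<and> (\<exists>F\<in>H. F \<subseteq> X \<and> card F = d + 1))"
    proof
      assume "X \<in> H"
      then show "X \<subseteq> V \<and>
          (card X < d + 1 \<or> card X = d + 1 \<and> (\<exists>F\<in>H. F \<subseteq> X \<and> card F = d + 1))"
        using sub card_le[of X] by auto
    next
      assume X: "X \<subseteq> V \<and>
          (card X < d + 1 \<or> card X = d + 1 \<and> (\<exists>F\<in>H. F \<subseteq> X \<and> card F = d + 1))"
      show "X \<in> H"
      proof (cases "card X < d + 1")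
        case True
        then show ?thesis using X fin low unfolding nsets_le_def by auto
      next
        case False
        then show ?thesis using X fin card_subset_eq by metis
      qed
    qed
    then show "X \<in> H \<longleftrightarrow>
        X \<in> nsets_le V (d + 1) - {X \<in> nsets V (d + 1). nsets X (d + 1) \<inter> H = {}}"
      unfolding nsets_le_diff_nsets_iff[OF \<open>finite V\<close>] .
  qed
qed

theorem theorem3p7:
  fixes V :: "'a set" and H :: "'a set set" and d m :: nat
  assumes "paving V H" and "complex_dim H = d"
  shows "(up V ^^ m) H =
    nsets_le V (d + m + 1) - {X \<in> nsets V (d + m + 1). nsets X (d + 1) \<inter> H = {}}"
proof (induction m)
  case 0
  show ?case using paving_eq_nsets_le_diff_nsets[OF assms] by simp
next
  case (Suc m)
  have "finite V" using assms(1) unfolding paving_def simplicial_complex_def by blast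
  \<comment> \<open>The side condition \<open>n \<le> k\<close> becomes
    \<open>d + 1 \<le> d + m + 1\<close>.\<close>
  then show ?case
    using Suc.IH up_nsets_le_diff_nsets[of V "d + m + 1" "d + 1" H] by simp
qed

end
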